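(* Let $\mathcal{H}$ be a Hilbert space. Then $$\mathcal{J}_{\mathfrak{X}}=\mathcal{J}_{\tilde{\mathcal{Q}}}\qquad\text{and}\qquad \mathcal{J}_{\mathfrak{X}_{cr}}=\mathcal{J}_{\mathcal{Q}}.$$
   Context: $R(\cdot)$, $N(\cdot)$, $\mathcal{D}(\cdot)$ denote range, nullspace and domain; $L(\mathcal{H})$ is the algebra of bounded linear operators on $\mathcal{H}$. $\mathfrak{X}$ is the set of all products $PQ$ of two orthogonal projections $P,Q\in L(\mathcal{H})$, and $\mathfrak{X}_{cr}=\{T\in\mathfrak{X}:R(T)\text{ is closed}\}$. $\mathcal{Q}=\{E\in L(\mathcal{H}):E^2=E\}$. $\tilde{\mathcal{Q}}$ is the set of closed, not necessarily bounded, projections: linear operators $E$ with dense domain $\mathcal{D}(E)\subseteq\mathcal{H}$ such that $\mathcal{D}(E)=N(E)\dot{+}R(E)$ (direct sum), $N(E)$ and $R(E)$ are closed in $\mathcal{H}$, and $E(Ex)=Ex$ for all $x\in\mathcal{D}(E)$; such $E$ are closed operators. The polar decomposition of a closed densely defined operator $C$ (in particular of $C\in L(\mathcal{H})$) is the unique factorization $C=V_C|C|$ with $|C|=(C^*C)^{1/2}$ and $V_C\in L(\mathcal{H})$ a partial isometry with $N(V_C)=N(C)$; $V_C$ is the isometric part of $C$. For a set $\mathcal{A}$ of such operators, $\mathcal{J}_{\mathcal{A}}=\{V_C:C\in\mathcal{A}\}$. *)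

theory Defs
  imports "HOL-Analysis.Analysis"
begin

text \<open>
  Complex Hilbert spaces. The norm and the topology are those of the real inner product
  \<open>inner x y = Re (cinner x y)\<close>, so \<open>norm x = sqrt (Re (cinner x x))\<close>.
  The inner product is linear in its first argument.
\<close>

class complex_hilbert_space = real_inner + complete_space +
  fixes scaleC :: "complex \<Rightarrow> 'a \<Rightarrow> 'a"  (infixr \<open>*\<^sub>C\<close> 75)
    and cinner :: "'a \<Rightarrow> 'a \<Rightarrow> complex"
  assumes scaleC_add_right: "a *\<^sub>C (x + y) = a *\<^sub>C x + a *\<^sub>C y"
    and scaleC_add_left: "(a + b) *\<^sub>C x = a *\<^sub>C x + b *\<^sub>C x"
    and scaleC_scaleC: "a *\<^sub>C (b *\<^sub>C x) = (a * b) *\<^sub>C x"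
    and scaleR_scaleC: "r *\<^sub>R x = complex_of_real r *\<^sub>C x"
    and cinner_commute: "cinner x y = cnj (cinner y x)"
    and cinner_add_left: "cinner (x + y) z = cinner x z + cinner y z"
    and cinner_scaleC_left: "cinner (a *\<^sub>C x) y = a * cinner x y"
    and inner_eq_Re_cinner: "inner x y = Re (cinner x y)"

instantiation complex :: complex_hilbert_space
begin

definition scaleC_complex :: "complex \<Rightarrow> complex \<Rightarrow> complex"
  where "scaleC_complex a x = a * x"

definition cinner_complex :: "complex \<Rightarrow> complex \<Rightarrow> complex"
  where "cinner_complex x y = x * cnj y"

instance
  by standard
    (simp_all add: scaleC_complex_def cinner_complex_def algebra_simps scaleR_conv_of_real
      inner_complex_def)

end

definition bounded_operators :: "('a::complex_hilbert_space \<Rightarrow> 'a) set"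
  where "bounded_operators = {T. bounded_linear T \<and> (\<forall>c x. T (c *\<^sub>C x) = c *\<^sub>C T x)}"

text \<open>
  A not necessarily everywhere defined operator is represented by its graph, a set of
  pairs \<open>(x, Cx)\<close>. Its domain and range are \<^const>\<open>Domain\<close> and
  \<^const>\<open>Range\<close>, and equality of graphs includes equality of domains.
  The product \<open>S T\<close> on its natural domain \<open>{x \<in> D(T). T x \<in> D(S)}\<close> is the
  relational composition \<open>T O S\<close> (note the order of the factors).
\<close>

definition linear_operator :: "('a::complex_hilbert_space \<times> 'a) set \<Rightarrow> bool"
  where "linear_operator C \<longleftrightarrow>
    single_valued C \<and> (0, 0) \<in> C \<and>
    (\<forall>x y x' y'. (x, y) \<in> C \<longrightarrow> (x', y') \<in> C \<longrightarrow> (x + x', y + y') \<in> C) \<and>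
    (\<forall>c x y. (x, y) \<in> C \<longrightarrow> (c *\<^sub>C x, c *\<^sub>C y) \<in> C)"

definition densely_defined :: "('a::complex_hilbert_space \<times> 'a) set \<Rightarrow> bool"
  where "densely_defined C \<longleftrightarrow> closure (Domain C) = UNIV"

definition nullspace :: "('a::complex_hilbert_space \<times> 'a) set \<Rightarrow> 'a set"
  where "nullspace C = {x. (x, 0) \<in> C}"

definition op_graph :: "('a::complex_hilbert_space \<Rightarrow> 'a) \<Rightarrow> ('a \<times> 'a) set"
  where "op_graph T = {(x, T x) | x. True}"

text \<open>
  For densely defined \<open>C\<close>: \<open>y\<close> lies in the domain of \<open>C\<^sup>*\<close> with
  \<open>C\<^sup>* y = z\<close> iff \<open>\<langle>C x, y\<rangle> = \<langle>x, z\<rangle>\<close> for all \<open>x\<close> in the domain of \<open>C\<close>.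
\<close>

definition op_adjoint :: "('a::complex_hilbert_space \<times> 'a) set \<Rightarrow> ('a \<times> 'a) set"
  where "op_adjoint C = {(y, z). \<forall>(x, w) \<in> C. cinner w y = cinner x z}"

definition positive_selfadjoint :: "('a::complex_hilbert_space \<times> 'a) set \<Rightarrow> bool"
  where "positive_selfadjoint A \<longleftrightarrow>
    linear_operator A \<and> densely_defined A \<and> op_adjoint A = A \<and>
    (\<forall>(x, y) \<in> A. cinner y x \<in> \<real> \<and> 0 \<le> Re (cinner y x))"

text \<open>\<open>A = (C\<^sup>* C)\<^bsup>1/2\<^esup>\<close>; the positive selfadjoint square root is unique.\<close>

definition is_modulus :: "('a::complex_hilbert_space \<times> 'a) set \<Rightarrow> ('a \<times> 'a) set \<Rightarrow> bool"
  where "is_modulus C A \<longleftrightarrow> positive_selfadjoint A \<and> A O A = C O op_adjoint C"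

definition partial_isometry :: "('a::complex_hilbert_space \<Rightarrow> 'a) \<Rightarrow> bool"
  where "partial_isometry V \<longleftrightarrow> V \<in> bounded_operators \<and>
    (\<forall>x. (\<forall>n. V n = 0 \<longrightarrow> cinner x n = 0) \<longrightarrow> norm (V x) = norm x)"

definition polar_decomposition ::
    "('a::complex_hilbert_space \<times> 'a) set \<Rightarrow> ('a \<Rightarrow> 'a) \<Rightarrow> ('a \<times> 'a) set \<Rightarrow> bool"
  where "polar_decomposition C V A \<longleftrightarrow>
    is_modulus C A \<and> partial_isometry V \<and> {x. V x = 0} = nullspace C \<and>
    C = A O op_graph V"

definition isometric_parts ::
    "('a::complex_hilbert_space \<times> 'a) set set \<Rightarrow> ('a \<Rightarrow> 'a) set"
  where "isometric_parts \<A> = {V. \<exists>C\<in>\<A>. \<exists>A. polar_decomposition C V A}"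

definition orthogonal_projection :: "('a::complex_hilbert_space \<Rightarrow> 'a) \<Rightarrow> bool"
  where "orthogonal_projection P \<longleftrightarrow> P \<in> bounded_operators \<and> P \<circ> P = P \<and>
    (\<forall>x y. cinner (P x) y = cinner x (P y))"

definition projection_products :: "('a::complex_hilbert_space \<Rightarrow> 'a) set"
  where "projection_products =
    {P \<circ> Q | P Q. orthogonal_projection P \<and> orthogonal_projection Q}"

definition projection_products_cr :: "('a::complex_hilbert_space \<Rightarrow> 'a) set"
  where "projection_products_cr = {T \<in> projection_products. closed (range T)}"

definition bounded_projections :: "('a::complex_hilbert_space \<Rightarrow> 'a) set"
  where "bounded_projections = {E \<in> bounded_operators. E \<circ> E = E}"

definition closed_projections :: "('a::complex_hilbert_space \<times> 'a) set set"
  where "closed_projections = {E. linear_operator E \<and> densely_defined E \<and>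
    Domain E = {n + r | n r. n \<in> nullspace E \<and> r \<in> Range E} \<and>
    nullspace E \<inter> Range E = {0} \<and>
    closed (nullspace E) \<and> closed (Range E) \<and>
    (\<forall>(x, y) \<in> E. (y, y) \<in> E)}"

end

theory Submission
  imports Defs
begin

text \<open>
  Let \<open>M\<close> be the initial space of a partial isometry \<open>V\<close>. Both sets of isometric parts consist of
  those \<open>V\<close> with \<open>\<langle>Vx, x\<rangle> > 0\<close> for all nonzero \<open>x \<in> M\<close>, that is, those whose compression
  \<open>B\<close> to \<open>M\<close> is positive and injective. For a product \<open>T = PQ\<close> one has \<open>PV = V\<close> and \<open>Q = 1\<close>
  on \<open>M\<close>, hence \<open>\<langle>Vx, y\<rangle> = \<langle>Vx, Ty\<rangle> = \<langle>x, |T|y\<rangle>\<close>, so \<open>|T|\<close> acts on \<open>M\<close> as \<open>B\<close>; for a closed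
  projection \<open>E\<close> the vector \<open>x - Ex\<close> lies in \<open>N(E)\<close>, so \<open>|E|\<close> acts on \<open>M\<close> as \<open>B\<^sup>-\<^sup>1\<close>.
  Closedness of \<open>R(T)\<close> and boundedness of \<open>E\<close> both amount to \<open>B\<close> mapping onto \<open>M\<close>.
\<close>

subsection \<open>Orthogonal complements and projections\<close>

lemma cinner_add_right: "cinner x (y + z) = cinner x y + cinner x z"
  by (metis cinner_add_left cinner_commute complex_cnj_add)

lemma cinner_scaleC_right: "cinner x (a *\<^sub>C y) = cnj a * cinner x y"
  by (metis cinner_commute cinner_scaleC_left complex_cnj_mult)

lemma scaleC_minus1: "(- 1) *\<^sub>C x = - (x::'a::complex_hilbert_space)"
  using scaleR_scaleC[of "-1" x] by simp

lemma scaleC_zero_left [simp]: "0 *\<^sub>C x = (0::'a::complex_hilbert_space)"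
  using scaleR_scaleC[of 0 x] by simp

lemma scaleC_zero_right [simp]: "c *\<^sub>C 0 = (0::'a::complex_hilbert_space)"
  by (metis scaleC_add_right add_cancel_left_right)

lemma scaleC_diff_right: "c *\<^sub>C (x - y) = c *\<^sub>C x - c *\<^sub>C (y::'a::complex_hilbert_space)"
  by (metis scaleC_add_right eq_diff_eq)

lemma cinner_zero_left [simp]: "cinner 0 y = 0"
  using cinner_scaleC_left[of 0 0 y] by simp

lemma cinner_zero_right [simp]: "cinner y 0 = 0"
  using cinner_scaleC_right[of y 0 0] by simp

lemma cinner_diff_left: "cinner (x - y) z = cinner x z - cinner y z"
  by (metis cinner_add_left eq_diff_eq)

lemma cinner_diff_right: "cinner z (x - y) = cinner z x - cinner z y"
  by (metis cinner_add_right eq_diff_eq)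

lemmas cinner_algebra = cinner_add_left cinner_add_right cinner_diff_left cinner_diff_right
  cinner_scaleC_left cinner_scaleC_right

text \<open>The imaginary part is a real inner product with \<open>\<i> *\<^sub>C y\<close>, which
  lets real Hilbert space arguments carry over to \<open>cinner\<close>.\<close>

lemma cinner_eq_inner: "cinner x y = Complex (inner x y) (inner x (\<i> *\<^sub>C y))"
  by (simp add: complex_eq_iff inner_eq_Re_cinner cinner_scaleC_right)

lemma cinner_self: "cinner x x = complex_of_real ((norm x)\<^sup>2)"
proof -
  have "Im (cinner x x) = 0"
    using cinner_commute[of x x] by (metis complex_cnj_cancel_iff Im_complex_of_real Reals_cnj_iff complex_is_Real_iff)
  then show ?thesis
    by (simp add: complex_eq_iff power2_norm_eq_inner inner_eq_Re_cinner)
qed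

lemma cinner_self_eq_0 [simp]: "cinner x x = 0 \<longleftrightarrow> x = 0"
  by (simp add: cinner_self)

section \<open>Complex subspaces and orthogonal complements\<close>

definition csubspace :: "'a::complex_hilbert_space set \<Rightarrow> bool"
  where "csubspace S \<longleftrightarrow> 0 \<in> S \<and> (\<forall>x\<in>S. \<forall>y\<in>S. x + y \<in> S) \<and> (\<forall>c. \<forall>x\<in>S. c *\<^sub>C x \<in> S)"

lemma csubspace_imp_subspace: "csubspace S \<Longrightarrow> subspace S"
  by (simp add: csubspace_def subspace_def scaleR_scaleC)

lemma csubspaceD:
  assumes "csubspace S"
  shows "0 \<in> S" "x \<in> S \<Longrightarrow> y \<in> S \<Longrightarrow> x + y \<in> S" "x \<in> S \<Longrightarrow> y \<in> S \<Longrightarrow> x - y \<in> S"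
    "x \<in> S \<Longrightarrow> c *\<^sub>C x \<in> S"
  using assms subspace_diff[OF csubspace_imp_subspace[OF assms]] by (auto simp: csubspace_def)

definition orth :: "'a::complex_hilbert_space set \<Rightarrow> 'a set"
  where "orth S = {x. \<forall>s\<in>S. cinner x s = 0}"

lemma orthD: "x \<in> orth S \<Longrightarrow> s \<in> S \<Longrightarrow> cinner x s = 0"
  by (simp add: orth_def)

lemma orthD2: "x \<in> orth S \<Longrightarrow> s \<in> S \<Longrightarrow> cinner s x = 0"
  by (metis orthD cinner_commute complex_cnj_zero)

lemma orthI2: "(\<And>s. s \<in> S \<Longrightarrow> cinner s x = 0) \<Longrightarrow> x \<in> orth S"
  unfolding orth_def by (simp add: cinner_commute[of x])

lemma csubspace_orth: "csubspace (orth S)"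
  by (simp add: csubspace_def orth_def cinner_algebra)

lemma closed_orth: "closed (orth S)"
proof -
  have "orth S = (\<Inter>s\<in>S. {x. inner x s = 0} \<inter> {x. inner x (\<i> *\<^sub>C s) = 0})"
    by (auto simp: orth_def cinner_eq_inner complex_eq_iff)
  moreover have "closed {x. inner x (s::'a) = 0}" for s
    by (intro closed_Collect_eq continuous_intros)
  ultimately show ?thesis
    by (auto intro!: closed_INT)
qed

lemma orth_inter: "x \<in> S \<Longrightarrow> x \<in> orth S \<Longrightarrow> x = 0"
  using orthD[of x S x] by simp

lemma orth_cinner_eqI:
  assumes "csubspace S" "x \<in> S" "y \<in> S" "\<And>u. u \<in> S \<Longrightarrow> cinner x u = cinner y u"
  shows "x = y"
proof -
  have "x - y \<in> orth S"
    using assms by (simp add: orth_def cinner_algebra)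
  then show ?thesis
    using orth_inter[of "x - y" S] csubspaceD[OF assms(1)] assms by auto
qed

text \<open>Replacing \<open>s\<close> by \<open>\<i> *\<^sub>C s\<close>, which stays in
  \<open>S\<close>, makes the imaginary part of the complex product vanish as well.\<close>

lemma orth_real:
  assumes "csubspace S" "\<And>s. s \<in> S \<Longrightarrow> inner x s = 0"
  shows "x \<in> orth S"
  using assms by (simp add: orth_def cinner_eq_inner csubspace_def complex_eq_iff)

section \<open>Nearest points, orthogonal decomposition and density\<close>

text \<open>A minimizing sequence is Cauchy by the parallelogram law, and its limit stays in
  \<open>S\<close> by closedness.\<close>

lemma nearest_point_ex:
  fixes S :: "'a::{real_inner, complete_space} set"
  assumes S: "subspace S" "closed S"
  shows "\<exists>p\<in>S. \<forall>s\<in>S. norm (x - p) \<le> norm (x - s)"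
proof -
  define d where "d = (INF s\<in>S. (norm (x - s))\<^sup>2)"
  have bdd: "bdd_below ((\<lambda>s. (norm (x - s))\<^sup>2) ` S)"
    by (auto intro!: bdd_belowI[of _ 0])
  have ne: "S \<noteq> {}"
    using S subspace_0 by blast
  have d_le: "d \<le> (norm (x - s))\<^sup>2" if "s \<in> S" for s
    unfolding d_def using bdd that by (rule cINF_lower)
  have "\<exists>s\<in>S. (norm (x - s))\<^sup>2 < d + inverse (real (Suc n))" for n
    using cINF_less_iff[OF ne bdd, of "d + inverse (real (Suc n))"] d_def by simp
  then obtain s where s: "\<And>n. s n \<in> S"
      and sd: "\<And>n. (norm (x - s n))\<^sup>2 < d + inverse (real (Suc n))"
    by metis
  \<comment> \<open>Parallelogram law for \<open>x - s m\<close> and \<open>x - s n\<close>: the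
    midpoint of \<open>s m\<close> and \<open>s n\<close> belongs to \<open>S\<close>, so its
    squared distance to \<open>x\<close> is at least \<open>d\<close>.\<close>
  have par: "(norm (s m - s n))\<^sup>2 \<le> 2 * inverse (real (Suc m)) + 2 * inverse (real (Suc n))" for m n
  proof -
    have "(1/2) *\<^sub>R (s m + s n) \<in> S"
      using S s by (simp add: subspace_add subspace_scale)
    then have "d \<le> (norm (x - (1/2) *\<^sub>R (s m + s n)))\<^sup>2"
      by (rule d_le)
    moreover have "(norm (s m - s n))\<^sup>2 = 2 * (norm (x - s m))\<^sup>2 + 2 * (norm (x - s n))\<^sup>2
        - 4 * (norm (x - (1/2) *\<^sub>R (s m + s n)))\<^sup>2"
      by (simp add: power2_norm_eq_inner inner_simps inner_commute field_simps)
    ultimately show ?thesis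
      using sd[of m] sd[of n] by linarith
  qed
  have "Cauchy s"
  proof (rule metric_CauchyI)
    fix e :: real assume e: "0 < e"
    then obtain N where N: "inverse (real (Suc N)) < e\<^sup>2 / 4"
      using reals_Archimedean[of "e\<^sup>2 / 4"] by auto
    have "dist (s m) (s n) < e" if "m \<ge> N" "n \<ge> N" for m n
    proof -
      have inv: "inverse (real (Suc k)) \<le> inverse (real (Suc N))" if "k \<ge> N" for k
        using that by (simp add: le_imp_inverse_le)
      have "(norm (s m - s n))\<^sup>2 < e\<^sup>2"
        using par[of m n] inv[OF that(1)] inv[OF that(2)] N by linarith
      then show ?thesis
        using e by (simp add: dist_norm power2_less_imp_less)
    qed
    then show "\<exists>N. \<forall>m\<ge>N. \<forall>n\<ge>N. dist (s m) (s n) < e"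
      by blast
  qed
  then obtain p where p: "s \<longlonglongrightarrow> p"
    using Cauchy_convergent_iff convergent_def by blast
  have "p \<in> S"
    using S(2) s p closed_sequentially by blast
  moreover have "(norm (x - p))\<^sup>2 \<le> d"
  proof (rule LIMSEQ_le)
    show "(\<lambda>n. (norm (x - s n))\<^sup>2) \<longlonglongrightarrow> (norm (x - p))\<^sup>2"
      by (intro tendsto_intros p)
    show "(\<lambda>n. d + inverse (real (Suc n))) \<longlonglongrightarrow> d"
      using LIMSEQ_inverse_real_of_nat_add by simp
  qed (use sd in \<open>auto intro: less_imp_le\<close>)
  ultimately show ?thesis
    using d_le by (meson norm_ge_zero order_trans power2_le_imp_le)
qed

text \<open>If the residual at a nearest point had a nonzero product with some \<open>s\<close>,
  moving the point along \<open>s\<close> would bring it closer to \<open>x\<close>.\<close>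

lemma orthogonal_decomposition_real:
  fixes S :: "'a::{real_inner, complete_space} set"
  assumes S: "subspace S" "closed S"
  shows "\<exists>p\<in>S. \<forall>s\<in>S. inner (x - p) s = 0"
proof -
  obtain p where p: "p \<in> S" and min: "\<And>s. s \<in> S \<Longrightarrow> norm (x - p) \<le> norm (x - s)"
    using nearest_point_ex[OF S] by blast
  have "inner (x - p) s = 0" if s: "s \<in> S" for s
  proof (rule ccontr)
    assume n: "inner (x - p) s \<noteq> 0"
    then have s0: "inner s s > 0"
      by auto
    \<comment> \<open>The minimizer over real \<open>t\<close> of the squared distance from
      \<open>x\<close> to \<open>p + t *\<^sub>R s\<close>.\<close>
    define t where "t = inner (x - p) s / inner s s"
    have "p + t *\<^sub>R s \<in> S"
      using S p s by (simp add: subspace_add subspace_scale)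
    then have "(norm (x - p))\<^sup>2 \<le> (norm (x - (p + t *\<^sub>R s)))\<^sup>2"
      using min by (simp add: power_mono)
    also have "\<dots> = (norm (x - p))\<^sup>2 - 2 * t * inner (x - p) s + t * (t * inner s s)"
      unfolding diff_diff_eq[symmetric]
      by (simp add: power2_norm_eq_inner inner_simps inner_commute algebra_simps)
    also have "t * inner s s = inner (x - p) s"
      using s0 by (simp add: t_def)
    finally have "t * inner (x - p) s \<le> 0"
      by simp
    moreover have "t * inner (x - p) s > 0"
      using n s0 by (simp add: t_def flip: power2_eq_square)
    ultimately show False by simp
  qed
  with p show ?thesis by blast
qed

lemma orthogonal_decomposition:
  assumes "csubspace S" "closed S"
  obtains p where "p \<in> S" "x - p \<in> orth S"
proof -
  obtain p where p: "p \<in> S" "\<And>s. s \<in> S \<Longrightarrow> inner (x - p) s = 0"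
    using orthogonal_decomposition_real[OF csubspace_imp_subspace[OF assms(1)] assms(2)] by blast
  then have "x - p \<in> orth S"
    by (intro orth_real[OF assms(1)])
  with p(1) show ?thesis by (rule that)
qed

lemma subspace_closure:
  fixes S :: "'a::real_normed_vector set"
  assumes S: "subspace S"
  shows "subspace (closure S)"
proof (rule subspaceI)
  show "0 \<in> closure S"
    using S closure_subset subspace_0 by blast
next
  fix x y assume "x \<in> closure S" "y \<in> closure S"
  then obtain u v where "\<And>n. u n \<in> S" "u \<longlonglongrightarrow> x" "\<And>n. v n \<in> S" "v \<longlonglongrightarrow> y"
    unfolding closure_sequential by blast
  then have "\<forall>n. u n + v n \<in> S" "(\<lambda>n. u n + v n) \<longlonglongrightarrow> x + y"
    using S by (auto intro: tendsto_add subspace_add)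
  then show "x + y \<in> closure S"
    unfolding closure_sequential by (intro exI conjI)
next
  fix c x assume "x \<in> closure S"
  then obtain u where "\<And>n. u n \<in> S" "u \<longlonglongrightarrow> x"
    unfolding closure_sequential by blast
  then have "\<forall>n. c *\<^sub>R u n \<in> S" "(\<lambda>n. c *\<^sub>R u n) \<longlonglongrightarrow> c *\<^sub>R x"
    using S by (auto intro: tendsto_scaleR subspace_scale)
  then show "c *\<^sub>R x \<in> closure S"
    unfolding closure_sequential by (intro exI conjI)
qed

text \<open>The residual of the projection onto \<open>closure S\<close> is orthogonal to
  \<open>S\<close>, hence zero. Projecting with real scalars suffices, because
  \<open>orth_real\<close> only asks \<open>S\<close> itself to be complex.\<close>

lemma dense_if_orth_trivial:
  assumes S: "csubspace S" and triv: "orth S \<subseteq> {0}"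
  shows "closure S = UNIV"
proof -
  have sub: "subspace (closure S)"
    by (rule subspace_closure) (rule csubspace_imp_subspace[OF S])
  have "x \<in> closure S" for x
  proof -
    obtain p where p: "p \<in> closure S" "\<And>s. s \<in> closure S \<Longrightarrow> inner (x - p) s = 0"
      using orthogonal_decomposition_real[OF sub closed_closure] by blast
    then have "x - p \<in> orth S"
      using S closure_subset by (intro orth_real) auto
    then show ?thesis
      using triv p by auto
  qed
  then show ?thesis by auto
qed

lemma orth_orth:
  assumes "csubspace S" "closed S"
  shows "orth (orth S) = S"
proof
  show "orth (orth S) \<subseteq> S"
  proof
    fix x assume x: "x \<in> orth (orth S)"
    obtain p where p: "p \<in> S" "x - p \<in> orth S"
      using orthogonal_decomposition assms by blast
    have "p \<in> orth (orth S)"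
      using p orthD2 by (auto simp: orth_def[of "orth S"])
    then have "x - p \<in> orth (orth S)"
      by (rule csubspaceD(3)[OF csubspace_orth x])
    then show "x \<in> S"
      using p orth_inter by fastforce
  qed
next
  show "S \<subseteq> orth (orth S)"
    using orthD2 by (auto simp: orth_def[of "orth S"])
qed

text \<open>For \<open>x\<close> in \<open>M\<close>, the residual of its projection onto
  \<open>S\<close> lies in \<open>M\<close> and in \<open>orth S\<close>, so it vanishes.\<close>

lemma closed_subspace_eqI:
  assumes S: "csubspace S" "closed S" and M: "csubspace M" "S \<subseteq> M" "M \<inter> orth S \<subseteq> {0}"
  shows "S = M"
proof
  show "M \<subseteq> S"
  proof
    fix x assume x: "x \<in> M"
    obtain p where p: "p \<in> S" "x - p \<in> orth S"
      using orthogonal_decomposition S by blast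
    then have "x - p \<in> M"
      using x M csubspaceD(3)[OF M(1)] by blast
    then show "x \<in> S"
      using p M(3) by auto
  qed
qed (rule M(2))

text \<open>Linearity and idempotence both come from uniqueness of the splitting into a part in
  \<open>S\<close> and a part in \<open>orth S\<close>.\<close>

lemma ex_orthogonal_projection:
  assumes S: "csubspace S" "closed S"
  obtains P where "orthogonal_projection P" "\<And>x. P x \<in> S" "\<And>x. x - P x \<in> orth S"
proof -
  have "\<forall>x. \<exists>p. p \<in> S \<and> x - p \<in> orth S"
    using orthogonal_decomposition[OF S] by blast
  then obtain P where P: "\<And>x. P x \<in> S" "\<And>x. x - P x \<in> orth S"
    by metis
  have uniq: "P x = p" if "p \<in> S" "x - p \<in> orth S" for x p
  proof -
    have "x - p - (x - P x) \<in> orth S"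
      using that P csubspaceD(3)[OF csubspace_orth] by blast
    then have "P x - p \<in> orth S" by simp
    moreover have "P x - p \<in> S"
      using csubspaceD(3)[OF S(1)] that P by blast
    ultimately show ?thesis
      using orth_inter by fastforce
  qed
  have add: "P (x + y) = P x + P y" for x y
  proof (rule uniq)
    show "x + y - (P x + P y) \<in> orth S"
      using csubspaceD(2)[OF csubspace_orth P(2)[of x] P(2)[of y]] by (simp add: algebra_simps)
  qed (use csubspaceD[OF S(1)] P in auto)
  have sc: "P (c *\<^sub>C x) = c *\<^sub>C P x" for c x
  proof (rule uniq)
    show "c *\<^sub>C x - c *\<^sub>C P x \<in> orth S"
      using csubspaceD(4)[OF csubspace_orth P(2)[of x], of c] by (simp add: scaleC_diff_right)
  qed (use csubspaceD[OF S(1)] P in auto)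
  have idem: "P (P x) = P x" for x
    by (rule uniq) (use P csubspaceD[OF csubspace_orth] in auto)
  have sym: "cinner (P x) y = cinner x (P y)" for x y
    using orthD2[OF P(2)[of y] P(1)[of x]] orthD[OF P(2)[of x] P(1)[of y]] by (simp add: cinner_algebra)
  have "norm (P x) \<le> norm x" for x
  proof -
    have "norm (P x) * norm (P x) = inner x (P x)"
      using sym[of x "P x"] idem
      by (simp add: inner_eq_Re_cinner power2_norm_eq_inner flip: power2_eq_square)
    also have "\<dots> \<le> norm x * norm (P x)"
      by (rule norm_cauchy_schwarz)
    finally show ?thesis
      by (cases "P x = 0") auto
  qed
  then have "bounded_linear P"
    by (intro bounded_linear_intro[where K=1]) (auto simp: add scaleR_scaleC sc)
  then have "orthogonal_projection P"
    by (auto simp: orthogonal_projection_def bounded_operators_def sc idem sym)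
  then show ?thesis
    using that P by blast
qed

text \<open>
  By Baire, some set \<open>F k\<close> on which the functionals \<open>inner (f u)\<close>, \<open>norm u \<le> 1\<close>, are bounded by \<open>k\<close>
  has an interior point.
\<close>

lemma Hellinger_Toeplitz:
  fixes f :: "'a::{real_inner, complete_space} \<Rightarrow> 'a"
  assumes f: "linear f" and sym: "\<And>x y. inner (f x) y = inner x (f y)"
  shows "bounded_linear f"
proof -
  define F where "F k = {x. \<forall>u. norm u \<le> 1 \<longrightarrow> \<bar>inner (f u) x\<bar> \<le> real k}" for k
  have F: "closed (F k)" for k
  proof -
    have "F k = (\<Inter>u\<in>cball 0 1. {x. \<bar>inner (f u) x\<bar> \<le> real k})"
      by (auto simp: F_def)
    moreover have "closed {x. \<bar>inner (f u) x\<bar> \<le> real k}" for u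
      by (intro closed_Collect_le continuous_intros)
    ultimately show ?thesis
      by (auto intro!: closed_INT)
  qed
  have U: "\<Union> (range F) = UNIV"
  proof -
    have "\<exists>k. x \<in> F k" for x
    proof -
      obtain k where k: "norm (f x) \<le> real k"
        using real_arch_simple by blast
      have "\<bar>inner (f u) x\<bar> \<le> real k" if "norm u \<le> 1" for u
      proof -
        have "\<bar>inner (f u) x\<bar> \<le> norm u * norm (f x)"
          unfolding sym by (rule Cauchy_Schwarz_ineq2)
        also have "\<dots> \<le> norm (f x)"
          using that by (simp add: mult_left_le_one_le)
        finally show ?thesis using k by simp
      qed
      then show ?thesis by (auto simp: F_def)
    qed
    then show ?thesis by auto
  qed
  have "\<exists>k. interior (F k) \<noteq> {}"
  proof (rule ccontr)
    assume "\<nexists>k. interior (F k) \<noteq> {}"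
    then have "euclidean interior_of \<Union> (range F) = {}"
      using F by (intro Baire_category_alt) (auto simp: completely_metrizable_space_euclidean)
    then show False
      using U by simp
  qed
  then obtain k x0 r where r: "r > 0" "cball x0 r \<subseteq> F k"
    by (meson equals0I mem_interior_cball)
  have "norm (f u) \<le> 2 * real k / r" if u: "norm u \<le> 1" for u
  proof (cases "f u = 0")
    case False
    \<comment> \<open>This multiple of \<open>f u\<close> has norm \<open>r\<close>, so
      \<open>x0 + v\<close> stays in the ball. Comparing the bounds at \<open>x0\<close> and
      \<open>x0 + v\<close> bounds \<open>inner (f u) v\<close>, which equals
      \<open>r * norm (f u)\<close>.\<close>
    define v where "v = (r / norm (f u)) *\<^sub>R f u"
    have "norm v = r"
      using False r by (simp add: v_def)
    then have "x0 \<in> F k" "x0 + v \<in> F k"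
      using r by (auto simp: dist_norm)
    then have "\<bar>inner (f u) x0\<bar> \<le> real k" "\<bar>inner (f u) (x0 + v)\<bar> \<le> real k"
      using u by (auto simp: F_def)
    then have "inner (f u) v \<le> 2 * real k"
      by (simp add: inner_add_right)
    then have "r * norm (f u) \<le> 2 * real k"
      using False by (simp add: v_def power2_eq_square flip: power2_norm_eq_inner)
    then show ?thesis
      using r by (simp add: field_simps)
  qed (use r in auto)
  note bound = this
  have "norm (f x) \<le> norm x * (2 * real k / r)" for x
  proof (cases "x = 0")
    case False
    have "norm (f (inverse (norm x) *\<^sub>R x)) \<le> 2 * real k / r"
      using False by (intro bound) simp
    then have "norm (f x) / norm x \<le> 2 * real k / r"
      by (simp add: linear_scale[OF f] divide_inverse mult.commute)
    then show ?thesis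
      using False by (simp add: pos_divide_le_eq mult.commute)
  qed (simp add: linear_0[OF f])
  then show ?thesis
    using f by (intro bounded_linear_intro[where K="2 * real k / r"]) (auto simp: linear_add linear_scale)
qed

subsection \<open>Partial isometries and polar decompositions\<close>

abbreviation initial_space :: "('a::complex_hilbert_space \<Rightarrow> 'a) \<Rightarrow> 'a set"
  where "initial_space V \<equiv> orth {x. V x = 0}"

lemma bounded_operatorsD:
  assumes "V \<in> bounded_operators"
  shows "bounded_linear V" "V (x + y) = V x + V y" "V (x - y) = V x - V y"
    "V (c *\<^sub>C x) = c *\<^sub>C V x" "V 0 = 0"
proof -
  show V: "bounded_linear V" "V (c *\<^sub>C x) = c *\<^sub>C V x"
    using assms by (simp_all add: bounded_operators_def)
  note lin = bounded_linear.linear[OF V(1)]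
  show "V (x + y) = V x + V y" "V (x - y) = V x - V y" "V 0 = 0"
    by (rule linear_add[OF lin], rule linear_diff[OF lin], rule linear_0[OF lin])
qed

lemma partial_isometryD: "partial_isometry V \<Longrightarrow> V \<in> bounded_operators"
  by (simp add: partial_isometry_def)

lemma csubspace_kernel: "V \<in> bounded_operators \<Longrightarrow> csubspace {x. V x = 0}"
  by (simp add: csubspace_def bounded_operatorsD)

lemma closed_kernel: "V \<in> bounded_operators \<Longrightarrow> closed {x. V x = 0}"
  by (intro closed_Collect_eq continuous_intros linear_continuous_on) (rule bounded_operatorsD)

lemma orth_initial_space: "V \<in> bounded_operators \<Longrightarrow> orth (initial_space V) = {x. V x = 0}"
  by (intro orth_orth csubspace_kernel closed_kernel)

lemma initial_space_decomposition:
  assumes "V \<in> bounded_operators"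
  obtains m where "m \<in> initial_space V" "V (x - m) = 0" "V x = V m"
proof -
  obtain m where m: "m \<in> initial_space V" "x - m \<in> orth (initial_space V)"
    using orthogonal_decomposition[OF csubspace_orth closed_orth] by blast
  then have "V (x - m) = 0"
    using orth_initial_space[OF assms] by auto
  then show ?thesis
    using that m bounded_operatorsD(3)[OF assms] by simp
qed

lemma partial_isometry_norm:
  "partial_isometry V \<Longrightarrow> x \<in> initial_space V \<Longrightarrow> norm (V x) = norm x"
  by (simp add: partial_isometry_def orth_def)

text \<open>Polarization recovers the real inner product from norms; applied to
  \<open>\<i> *\<^sub>C y\<close> it also yields the imaginary part.\<close>

lemma partial_isometry_cinner:
  assumes V: "partial_isometry V" and x: "x \<in> initial_space V" and y: "y \<in> initial_space V"
  shows "cinner (V x) (V y) = cinner x y"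
proof -
  note B = bounded_operatorsD[OF partial_isometryD[OF V]]
  have *: "inner (V x) (V y) = inner x y" if "y \<in> initial_space V" for y
    using partial_isometry_norm[OF V] x that csubspaceD(2)[OF csubspace_orth x that]
    by (simp add: dot_norm flip: B(2))
  show ?thesis
    using *[OF y] *[OF csubspaceD(4)[OF csubspace_orth y]] by (simp add: cinner_eq_inner B(4)[symmetric])
qed

lemma partial_isometry_inj:
  assumes V: "partial_isometry V" and "x \<in> initial_space V" "y \<in> initial_space V" "V x = V y"
  shows "x = y"
proof -
  have "norm (V (x - y)) = norm (x - y)"
    using assms by (intro partial_isometry_norm csubspaceD(3)[OF csubspace_orth])
  then show ?thesis
    using assms(4) bounded_operatorsD(3)[OF partial_isometryD[OF V]] by simp
qed

lemma range_eq_image_initial_space: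
  assumes "V \<in> bounded_operators"
  shows "range V = V ` initial_space V"
proof
  show "range V \<subseteq> V ` initial_space V"
  proof
    fix y assume "y \<in> range V"
    then obtain x where x: "y = V x" by blast
    obtain m where "m \<in> initial_space V" "V x = V m"
      using initial_space_decomposition[OF assms] by blast
    then show "y \<in> V ` initial_space V"
      using x by blast
  qed
qed blast

text \<open>The range is the isometric image of the initial space, which is closed and therefore
  complete.\<close>

lemma closed_range_partial_isometry:
  assumes V: "partial_isometry V"
  shows "closed (range V)"
proof -
  have "complete (V ` initial_space V)"
    using partial_isometry_norm[OF V]
    by (intro complete_isometric_image[where e=1] csubspace_imp_subspace csubspace_orth
        bounded_operatorsD(1) partial_isometryD V) (auto simp: complete_eq_closed closed_orth)
  then show ?thesis
    by (simp add: complete_eq_closed range_eq_image_initial_space[OF partial_isometryD[OF V]])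
qed

lemma csubspace_range: "V \<in> bounded_operators \<Longrightarrow> csubspace (range V)"
  unfolding csubspace_def
proof (intro conjI ballI allI)
  assume V: "V \<in> bounded_operators"
  note B = bounded_operatorsD[OF V]
  show "0 \<in> range V"
    using B(5) by (metis rangeI)
  show "x + y \<in> range V" if "x \<in> range V" "y \<in> range V" for x y
    using that by (auto simp: B(2)[symmetric])
  show "c *\<^sub>C x \<in> range V" if "x \<in> range V" for c x
    using that by (auto simp: B(4)[symmetric])
qed

section \<open>Linear and positive selfadjoint operators as graphs\<close>

lemma linear_operatorD:
  assumes "linear_operator A"
  shows "(x, y) \<in> A \<Longrightarrow> (x, y') \<in> A \<Longrightarrow> y = y'" "(0, 0) \<in> A"
    "(x, y) \<in> A \<Longrightarrow> (x', y') \<in> A \<Longrightarrow> (x + x', y + y') \<in> A"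
    "(x, y) \<in> A \<Longrightarrow> (c *\<^sub>C x, c *\<^sub>C y) \<in> A"
    "(x, y) \<in> A \<Longrightarrow> (x', y') \<in> A \<Longrightarrow> (x - x', y - y') \<in> A"
proof -
  show 1: "(x, y) \<in> A \<Longrightarrow> (x, y') \<in> A \<Longrightarrow> y = y'" "(0, 0) \<in> A"
    "(x, y) \<in> A \<Longrightarrow> (x', y') \<in> A \<Longrightarrow> (x + x', y + y') \<in> A"
    "(x, y) \<in> A \<Longrightarrow> (c *\<^sub>C x, c *\<^sub>C y) \<in> A" for x y x' y' c
    using assms unfolding linear_operator_def single_valued_def by blast+
  show "(x, y) \<in> A \<Longrightarrow> (x', y') \<in> A \<Longrightarrow> (x - x', y - y') \<in> A"
    using 1(3)[OF _ 1(4)[of x' y' "-1"], of x y] by (simp add: scaleC_minus1)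
qed

lemma csubspace_Domain: "linear_operator A \<Longrightarrow> csubspace (Domain A)"
  unfolding csubspace_def using linear_operatorD(2-4) by (metis Domain_iff)

lemma csubspace_Range: "linear_operator A \<Longrightarrow> csubspace (Range A)"
  unfolding csubspace_def using linear_operatorD(2-4) by (metis Range_iff)

text \<open>Polarization: reality of the form at \<open>x + y\<close> matches the imaginary parts,
  and at \<open>x + \<i> *\<^sub>C y\<close> the real parts.\<close>

lemma symmetric_if_real_form:
  assumes A: "linear_operator A" and real: "\<And>x w. (x, w) \<in> A \<Longrightarrow> cinner w x \<in> \<real>"
    and x: "(x, w) \<in> A" and y: "(y, z) \<in> A"
  shows "cinner w y = cinner x z"
proof -
  have 0: "Im (cinner w x) = 0" "Im (cinner z y) = 0"
    using real[OF x] real[OF y] by (simp_all add: complex_is_Real_iff)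
  have "Im (cinner (w + z) (x + y)) = 0"
    using real[OF linear_operatorD(3)[OF A x y]] by (simp add: complex_is_Real_iff)
  then have 1: "Im (cinner w y) + Im (cinner z x) = 0"
    using 0 by (simp add: cinner_algebra)
  have "Im (cinner (w + \<i> *\<^sub>C z) (x + \<i> *\<^sub>C y)) = 0"
    using real[OF linear_operatorD(3)[OF A x linear_operatorD(4)[OF A y]]]
    by (simp add: complex_is_Real_iff)
  then have 2: "Re (cinner z x) - Re (cinner w y) = 0"
    using 0 by (simp add: cinner_algebra)
  have "cinner x z = cnj (cinner z x)"
    by (rule cinner_commute)
  then show ?thesis
    using 1 2 by (simp add: complex_eq_iff)
qed

text \<open>Along \<open>x + t u\<close> the form is a real quadratic in \<open>t\<close> without
  constant term; nonnegativity forces its linear coefficient to vanish.\<close>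

lemma positive_form_null:
  assumes A: "linear_operator A"
    and pos: "\<And>x w. (x, w) \<in> A \<Longrightarrow> cinner w x \<in> \<real> \<and> 0 \<le> Re (cinner w x)"
    and x: "(x, w) \<in> A" "Re (cinner w x) = 0"
  shows "w \<in> orth (Domain A)"
proof (rule orth_real)
  show "csubspace (Domain A)"
    by (rule csubspace_Domain[OF A])
next
  fix u assume "u \<in> Domain A"
  then obtain v where u: "(u, v) \<in> A" by auto
  have sym: "inner v x = inner w u"
    using symmetric_if_real_form[OF A _ x(1) u] pos
    by (metis inner_commute inner_eq_Re_cinner)
  have q: "0 \<le> 2 * t * inner w u + t\<^sup>2 * inner v u" for t
  proof -
    have "(x + complex_of_real t *\<^sub>C u, w + complex_of_real t *\<^sub>C v) \<in> A"
      by (intro linear_operatorD(3)[OF A] linear_operatorD(4)[OF A] x u)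
    then have "0 \<le> inner (w + t *\<^sub>R v) (x + t *\<^sub>R u)"
      using pos by (simp add: inner_eq_Re_cinner scaleR_scaleC)
    also have "\<dots> = 2 * t * inner w u + t\<^sup>2 * inner v u"
      using x(2) sym by (simp add: inner_simps power2_eq_square algebra_simps flip: inner_eq_Re_cinner)
    finally show ?thesis .
  qed
  show "inner w u = 0"
  proof (rule ccontr)
    assume n: "inner w u \<noteq> 0"
    \<comment> \<open>The added 1 keeps the denominator of \<open>t\<close> positive even when
      \<open>inner v u\<close> is zero.\<close>
    define c where "c = inner v u + 1"
    have c: "c > 0"
      using pos[OF u] by (simp add: c_def inner_eq_Re_cinner)
    define t where "t = - inner w u / c"
    have "inner w u = - c * t" "inner v u = c - 1"
      using c by (simp add: t_def) (simp add: c_def)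
    then have "0 \<le> 2 * t * (- c * t) + t\<^sup>2 * (c - 1)"
      using q[of t] by simp
    also have "\<dots> = - ((c + 1) * t\<^sup>2)"
      by (simp add: power2_eq_square algebra_simps)
    also have "\<dots> < 0"
      using n c by (simp add: t_def)
    finally show False by simp
  qed
qed

text \<open>The set \<open>orth {w}\<close> is closed and contains the domain, so it is the whole
  space and contains \<open>w\<close> itself.\<close>

lemma orth_densely_defined:
  assumes "densely_defined A" "w \<in> orth (Domain A)"
  shows "w = 0"
proof -
  have "Domain A \<subseteq> orth {w}"
    using assms(2) orthD2 by (auto simp: orth_def[of "{w}"])
  then have "closure (Domain A) \<subseteq> orth {w}"
    using closed_orth closure_minimal by blast
  then show ?thesis
    using assms(1) orth_inter[of w "{w}"] by (auto simp: densely_defined_def)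
qed

lemma positive_selfadjointD:
  assumes "positive_selfadjoint A"
  shows "linear_operator A" "densely_defined A" "op_adjoint A = A"
    "(x, w) \<in> A \<Longrightarrow> cinner w x \<in> \<real>" "(x, w) \<in> A \<Longrightarrow> 0 \<le> Re (cinner w x)"
    "(x, w) \<in> A \<Longrightarrow> (y, z) \<in> A \<Longrightarrow> cinner w y = cinner x z"
    "(x, w) \<in> A \<Longrightarrow> Re (cinner w x) = 0 \<Longrightarrow> w = 0"
proof -
  show 1: "linear_operator A" "densely_defined A" "op_adjoint A = A"
    "(x, w) \<in> A \<Longrightarrow> cinner w x \<in> \<real>" "(x, w) \<in> A \<Longrightarrow> 0 \<le> Re (cinner w x)" for x w
    using assms by (auto simp: positive_selfadjoint_def)
  show "(x, w) \<in> A \<Longrightarrow> (y, z) \<in> A \<Longrightarrow> cinner w y = cinner x z"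
    using symmetric_if_real_form[OF 1(1,4)] .
  show "(x, w) \<in> A \<Longrightarrow> Re (cinner w x) = 0 \<Longrightarrow> w = 0"
    using positive_form_null[OF 1(1)] 1(4,5) orth_densely_defined[OF 1(2)] by blast
qed

text \<open>A real form makes \<open>A\<close> symmetric. The adjoint cannot be larger: every
  \<open>y\<close> already has an image under \<open>A\<close>, and testing against all vectors
  shows that the adjoint has the same value there.\<close>

lemma positive_selfadjoint_everywhere:
  assumes A: "linear_operator A" "Domain A = UNIV"
    and pos: "\<And>x w. (x, w) \<in> A \<Longrightarrow> cinner w x \<in> \<real> \<and> 0 \<le> Re (cinner w x)"
  shows "positive_selfadjoint A"
proof -
  have sym: "cinner w y = cinner x z" if "(x, w) \<in> A" "(y, z) \<in> A" for x w y z
    using symmetric_if_real_form[OF A(1)] pos that by blast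
  have adj: "(y, z) \<in> A" if z: "\<And>x w. (x, w) \<in> A \<Longrightarrow> cinner w y = cinner x z" for y z
  proof -
    obtain z' where z': "(y, z') \<in> A"
      using A(2) by blast
    have "z = z'"
    proof (rule orth_cinner_eqI[of UNIV])
      fix u :: 'a
      obtain w where "(u, w) \<in> A"
        using A(2) by blast
      then have "cinner u z = cinner u z'"
        using z sym z' by metis
      then show "cinner z u = cinner z' u"
        by (metis cinner_commute)
    qed (auto simp: csubspace_def)
    with z' show ?thesis by simp
  qed
  have "op_adjoint A = A"
  proof (intro equalityI subrelI)
    show "(y, z) \<in> A" if "(y, z) \<in> op_adjoint A" for y z
      using that by (intro adj) (auto simp: op_adjoint_def)
    show "(y, z) \<in> op_adjoint A" if "(y, z) \<in> A" for y z
      using sym that by (auto simp: op_adjoint_def)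
  qed
  then show ?thesis
    unfolding positive_selfadjoint_def densely_defined_def using A pos by auto
qed

section \<open>Kernel and range of the modulus\<close>

lemma polar_decompositionD:
  assumes "polar_decomposition C V A"
  shows "positive_selfadjoint A" "A O A = C O op_adjoint C" "partial_isometry V"
    "{x. V x = 0} = nullspace C" "C = A O op_graph V"
    "(x, y) \<in> C \<longleftrightarrow> (\<exists>w. (x, w) \<in> A \<and> y = V w)"
proof -
  show 1: "positive_selfadjoint A" "A O A = C O op_adjoint C" "partial_isometry V"
    "{x. V x = 0} = nullspace C" "C = A O op_graph V"
    using assms unfolding polar_decomposition_def is_modulus_def by blast+
  show "(x, y) \<in> C \<longleftrightarrow> (\<exists>w. (x, w) \<in> A \<and> y = V w)"
    by (subst 1(5)) (auto simp: op_graph_def)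
qed

text \<open>A vector in the kernel of \<open>V\<close> is sent to 0 by \<open>C\<close>, hence by
  the square of \<open>A\<close>. By symmetry its image \<open>w\<close> under \<open>A\<close> then
  satisfies \<open>cinner w w = 0\<close>.\<close>

lemma polar_modulus_kernel:
  assumes "polar_decomposition C V A"
  shows "(x, 0) \<in> A \<longleftrightarrow> V x = 0"
proof
  note D = polar_decompositionD[OF assms]
  note P = positive_selfadjointD[OF D(1)]
  show "V x = 0" if "(x, 0) \<in> A"
    using D(4) D(6)[of x 0] that bounded_operatorsD(5)[OF partial_isometryD[OF D(3)]]
    by (auto simp: nullspace_def)
  assume "V x = 0"
  then have "(x, 0) \<in> C"
    using D(4) by (auto simp: nullspace_def)
  moreover have "(0, 0) \<in> op_adjoint C"
    by (auto simp: op_adjoint_def)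
  ultimately have "(x, 0) \<in> A O A"
    using D(2) by blast
  then obtain w where w: "(x, w) \<in> A" "(w, 0) \<in> A"
    by blast
  then have "cinner w w = 0"
    using P(6)[OF w] by simp
  with w show "(x, 0) \<in> A" by simp
qed

text \<open>Symmetry of \<open>A\<close> moves it onto a kernel vector, where it vanishes.\<close>

lemma polar_modulus_Range:
  assumes "polar_decomposition C V A"
  shows "Range A \<subseteq> initial_space V"
proof -
  note P = positive_selfadjointD[OF polar_decompositionD(1)[OF assms]]
  have "cinner w n = 0" if "(x, w) \<in> A" "V n = 0" for x w n
    using P(6)[OF that(1), of n 0] that(2) polar_modulus_kernel[OF assms] by simp
  then show ?thesis
    by (auto simp: orth_def)
qed

text \<open>A vector orthogonal to the range is in the kernel of the adjoint of \<open>A\<close>,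
  which is \<open>A\<close> again.\<close>

lemma polar_modulus_orth_Range:
  assumes "polar_decomposition C V A"
  shows "orth (Range A) \<subseteq> {x. V x = 0}"
proof
  note P = positive_selfadjointD[OF polar_decompositionD(1)[OF assms]]
  fix y assume "y \<in> orth (Range A)"
  then have "(y, 0) \<in> op_adjoint A"
    using orthD2 by (fastforce simp: op_adjoint_def)
  then show "y \<in> {x. V x = 0}"
    using P(3) polar_modulus_kernel[OF assms] by auto
qed

text \<open>Since \<open>V\<close> is injective on its initial space, \<open>Range A\<close> is the
  preimage of \<open>Range C\<close> there, hence closed. Nothing nonzero in the initial space is
  orthogonal to it.\<close>

lemma polar_modulus_Range_eq:
  assumes pol: "polar_decomposition C V A" and cl: "closed (Range C)"
  shows "Range A = initial_space V"
proof (rule closed_subspace_eqI)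
  note D = polar_decompositionD[OF pol]
  have "Range A = initial_space V \<inter> V -` Range C"
  proof (intro equalityI subsetI)
    fix w assume w: "w \<in> initial_space V \<inter> V -` Range C"
    then obtain x w' where w': "(x, w') \<in> A" "V w = V w'"
      using D(6) by auto
    then have "w = w'"
      using partial_isometry_inj[OF D(3)] polar_modulus_Range[OF pol] w by blast
    with w' show "w \<in> Range A" by blast
  next
    fix w assume w: "w \<in> Range A"
    then show "w \<in> initial_space V \<inter> V -` Range C"
      using D(6) polar_modulus_Range[OF pol] by blast
  qed
  moreover have "closed (V -` Range C)"
    using cl by (intro closed_vimage linear_continuous_on bounded_operatorsD(1) partial_isometryD D(3))
  ultimately show "closed (Range A)"
    using closed_orth by (metis closed_Int)
  show "initial_space V \<inter> orth (Range A) \<subseteq> {0}"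
    using polar_modulus_orth_Range[OF pol] orth_inter by blast
qed (use csubspace_orth csubspace_Range positive_selfadjointD(1) polar_decompositionD(1) pol
    polar_modulus_Range in blast)+

text \<open>Because \<open>V\<close> preserves inner products on \<open>Range A\<close>, the adjoint
  of the product acts on \<open>V w\<close> as the adjoint of \<open>A\<close>, that is
  \<open>A\<close>, acts on \<open>w\<close>. This reduces the product of the adjoint with the
  operator to the square of \<open>A\<close>.\<close>

lemma polar_decompositionI:
  assumes A: "positive_selfadjoint A" "Range A \<subseteq> initial_space V" and V: "partial_isometry V"
    and ker: "{x. V x = 0} = nullspace (A O op_graph V)"
  shows "polar_decomposition (A O op_graph V) V A"
proof -
  let ?C = "A O op_graph V"
  have C: "(x, y) \<in> ?C \<longleftrightarrow> (\<exists>w. (x, w) \<in> A \<and> y = V w)" for x y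
    by (auto simp: op_graph_def)
  have "(V w, z) \<in> op_adjoint ?C \<longleftrightarrow> (w, z) \<in> A" if w: "w \<in> Range A" for w z
  proof -
    have "(V w, z) \<in> op_adjoint ?C \<longleftrightarrow> (\<forall>u v. (u, v) \<in> A \<longrightarrow> cinner (V v) (V w) = cinner u z)"
    proof -
      have "(V w, z) \<in> op_adjoint ?C \<longleftrightarrow> (\<forall>u y. (u, y) \<in> ?C \<longrightarrow> cinner y (V w) = cinner u z)"
        by (auto simp: op_adjoint_def)
      then show ?thesis
        unfolding C by blast
    qed
    also have "\<dots> \<longleftrightarrow> (\<forall>u v. (u, v) \<in> A \<longrightarrow> cinner v w = cinner u z)"
    proof -
      have "cinner (V v) (V w) = cinner v w" if "(u, v) \<in> A" for u v
        using partial_isometry_cinner[OF V] A(2) that w by blast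
      then show ?thesis by auto
    qed
    also have "\<dots> \<longleftrightarrow> (w, z) \<in> op_adjoint A"
      by (auto simp: op_adjoint_def)
    finally show ?thesis
      using positive_selfadjointD(3)[OF A(1)] by simp
  qed
  then have adj: "(x, w) \<in> A \<Longrightarrow> (V w, z) \<in> op_adjoint ?C \<longleftrightarrow> (w, z) \<in> A" for x w z
    by blast
  have "A O A = ?C O op_adjoint ?C"
  proof (intro equalityI subrelI)
    fix x z assume "(x, z) \<in> A O A"
    then obtain w where w: "(x, w) \<in> A" "(w, z) \<in> A"
      by blast
    then have "(x, V w) \<in> ?C" "(V w, z) \<in> op_adjoint ?C"
      using C adj by blast+
    then show "(x, z) \<in> ?C O op_adjoint ?C"
      by (rule relcompI)
  next
    fix x z assume "(x, z) \<in> ?C O op_adjoint ?C"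
    then obtain y where y: "(x, y) \<in> ?C" "(y, z) \<in> op_adjoint ?C"
      by (rule relcompE) simp
    then obtain w where w: "(x, w) \<in> A" "y = V w"
      using C by blast
    then have "(w, z) \<in> A"
      using adj y(2) by blast
    with w(1) show "(x, z) \<in> A O A"
      by (rule relcompI)
  qed
  then show ?thesis
    using A V ker by (simp add: polar_decomposition_def is_modulus_def)
qed

subsection \<open>Isometric parts\<close>

definition strictly_positive :: "('a::complex_hilbert_space \<Rightarrow> 'a) \<Rightarrow> bool"
  where "strictly_positive V \<longleftrightarrow> partial_isometry V \<and>
    (\<forall>x\<in>initial_space V. x \<noteq> 0 \<longrightarrow> cinner (V x) x \<in> \<real> \<and> 0 < Re (cinner (V x) x))"

text \<open>
  \<open>V\<close> vanishes exactly on the orthogonal complement of its initial space, so \<open>V (V w - y) = 0\<close>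
  says that \<open>y\<close> is the component of \<open>V w\<close> in the initial space.
\<close>

definition compression_onto :: "('a::complex_hilbert_space \<Rightarrow> 'a) \<Rightarrow> bool"
  where "compression_onto V \<longleftrightarrow> (\<forall>y\<in>initial_space V. \<exists>w\<in>initial_space V. V (V w - y) = 0)"

lemma strictly_positiveD:
  assumes V: "strictly_positive V"
  shows "partial_isometry V" "V \<in> bounded_operators"
    "x \<in> initial_space V \<Longrightarrow> cinner (V x) x \<in> \<real>"
    "x \<in> initial_space V \<Longrightarrow> 0 \<le> Re (cinner (V x) x)"
    "x \<in> initial_space V \<Longrightarrow> Re (cinner (V x) x) = 0 \<Longrightarrow> x = 0"
    "x \<in> initial_space V \<Longrightarrow> y \<in> initial_space V \<Longrightarrow> cinner (V x) y = cinner x (V y)"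
proof -
  show V1: "partial_isometry V" and V2: "V \<in> bounded_operators"
    using V by (auto simp: strictly_positive_def partial_isometry_def)
  show real: "cinner (V x) x \<in> \<real>" if "x \<in> initial_space V" for x
    using V that by (cases "x = 0") (auto simp: strictly_positive_def)
  show "0 \<le> Re (cinner (V x) x)" if "x \<in> initial_space V"
    using V that by (cases "x = 0") (auto simp: strictly_positive_def less_imp_le)
  show "x \<in> initial_space V \<Longrightarrow> Re (cinner (V x) x) = 0 \<Longrightarrow> x = 0"
    using V by (fastforce simp: strictly_positive_def)
  \<comment> \<open>The restriction of \<open>V\<close> to its initial space, a linear graph that
    need not be densely defined; polarizing its real form gives the symmetry.\<close>
  define B where "B = {(x, V x) | x. x \<in> initial_space V}"
  have "linear_operator B"
    using bounded_operatorsD[OF V2] csubspaceD[OF csubspace_orth[of "{x. V x = 0}"]]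
    by (auto simp: linear_operator_def single_valued_def B_def)
  then show "cinner (V x) y = cinner x (V y)" if "x \<in> initial_space V" "y \<in> initial_space V"
    by (rule symmetric_if_real_form) (use real that in \<open>auto simp: B_def\<close>)
qed

section \<open>Products of two projections\<close>

lemma orthogonal_projectionD:
  assumes "orthogonal_projection P"
  shows "P \<in> bounded_operators" "P (P x) = P x" "cinner (P x) y = cinner x (P y)"
  using assms by (auto simp: orthogonal_projection_def fun_eq_iff)

text \<open>As \<open>Q\<close> fixes the initial space and \<open>P\<close> fixes the range of
  \<open>V\<close>, the form of \<open>V\<close> on the initial space is that of the modulus. It is
  strict because the modulus kills no nonzero vector there.\<close>

lemma projection_product_strictly_positive:
  fixes V :: "'a::complex_hilbert_space \<Rightarrow> 'a"
  assumes P: "orthogonal_projection P" and Q: "orthogonal_projection Q"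
    and pol: "polar_decomposition (op_graph (P \<circ> Q)) V A"
  shows "strictly_positive V" and "closed (range (P \<circ> Q)) \<Longrightarrow> compression_onto V"
proof -
  note D = polar_decompositionD[OF pol]
  note S = positive_selfadjointD[OF D(1)]
  note BV = bounded_operatorsD[OF partial_isometryD[OF D(3)]]
  note BP = bounded_operatorsD[OF orthogonal_projectionD(1)[OF P]]
  note BQ = bounded_operatorsD[OF orthogonal_projectionD(1)[OF Q]]
  have T: "P (Q x) = y \<longleftrightarrow> (\<exists>w. (x, w) \<in> A \<and> y = V w)" for x y
    using D(6)[of x y] by (auto simp: op_graph_def)
  have total: "\<exists>w. (x, w) \<in> A \<and> P (Q x) = V w" for x
    using T by blast
  have kerT: "V x = 0 \<longleftrightarrow> P (Q x) = 0" for x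
    using D(4) by (auto simp: nullspace_def op_graph_def)
  \<comment> \<open>The vector \<open>y - Q y\<close> is killed by \<open>Q\<close>, hence by
    \<open>V\<close>, so \<open>y\<close> is orthogonal to it; \<open>Q y\<close> is orthogonal to
    it because \<open>Q\<close> is symmetric.\<close>
  have Qfix: "Q y = y" if y: "y \<in> initial_space V" for y
  proof -
    have "Q (y - Q y) = 0"
      using BQ(3) orthogonal_projectionD(2)[OF Q] by simp
    then have "cinner y (y - Q y) = 0" "cinner (Q y) (y - Q y) = 0"
      using orthD[OF y, of "y - Q y"] kerT[of "y - Q y"] BP(5) orthogonal_projectionD(3)[OF Q, of y "y - Q y"]
      by auto
    then have "cinner (y - Q y) (y - Q y) = 0"
      by (simp only: cinner_diff_left diff_self)
    then show ?thesis by simp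
  qed
  \<comment> \<open>The vectors with this property form a closed subspace containing the kernel of
    \<open>V\<close> and \<open>Range A\<close>; only 0 is orthogonal to both.\<close>
  have Pfix: "P (V x) = V x" for x
  proof -
    let ?F = "{x. P (V x) = V x}"
    have F: "csubspace ?F"
      by (simp add: csubspace_def BP BV)
    have "{x. V x = 0} \<subseteq> ?F" "Range A \<subseteq> ?F"
      using T orthogonal_projectionD(2)[OF P] by (auto simp: BP(5)) (metis)
    then have "orth ?F \<subseteq> initial_space V" "orth ?F \<subseteq> orth (Range A)"
      by (auto simp: orth_def)
    then have "orth ?F \<subseteq> {0}"
      using polar_modulus_orth_Range[OF pol] orth_inter by blast
    then have "closure ?F = UNIV"
      by (rule dense_if_orth_trivial[OF F])
    moreover have "closed ?F"
      by (intro closed_Collect_eq linear_continuous_on bounded_linear_compose[OF BP(1) BV(1), unfolded o_def] BV(1))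
    ultimately have "?F = UNIV"
      using closure_closed by simp
    then show ?thesis by blast
  qed
  have form: "cinner (V x) y = cinner x w"
    if "x \<in> initial_space V" "y \<in> initial_space V" "(y, w) \<in> A" for x y w
  proof -
    have "cinner (V x) y = cinner (P (V x)) (Q y)"
      using Pfix Qfix that by simp
    also have "\<dots> = cinner (V x) (P (Q y))"
      by (rule orthogonal_projectionD(3)[OF P])
    also have "P (Q y) = V w"
      using T that(3) by blast
    also have "cinner (V x) (V w) = cinner x w"
      using that polar_modulus_Range[OF pol] by (intro partial_isometry_cinner[OF D(3)]) auto
    finally show ?thesis .
  qed
  have "cinner (V x) x \<in> \<real> \<and> 0 < Re (cinner (V x) x)" if x: "x \<in> initial_space V" "x \<noteq> 0" for x
  proof -
    obtain w where w: "(x, w) \<in> A"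
      using total by blast
    have eq: "cinner (V x) x = cnj (cinner w x)"
      using form[OF x(1) x(1) w] by (metis cinner_commute)
    have "w \<noteq> 0"
      using w x polar_modulus_kernel[OF pol] orth_inter[of x "{x. V x = 0}"] by blast
    then have "Re (cinner w x) \<noteq> 0"
      using S(7)[OF w] by blast
    then show ?thesis
      using S(4,5)[OF w] by (simp add: eq Reals_cnj_iff)
  qed
  then show sp: "strictly_positive V"
    using D(3) by (simp add: strictly_positive_def)
  assume "closed (range (P \<circ> Q))"
  moreover have "Range (op_graph (P \<circ> Q)) = range (P \<circ> Q)"
    by (auto simp: op_graph_def)
  ultimately have R: "Range A = initial_space V"
    using polar_modulus_Range_eq[OF pol] by simp
  show "compression_onto V"
    unfolding compression_onto_def
  proof
    fix y assume y: "y \<in> initial_space V"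
    then obtain x where x: "(x, y) \<in> A"
      using R by auto
    \<comment> \<open>Dropping the kernel component of \<open>x\<close> leaves its image under
      \<open>A\<close> unchanged, so \<open>y\<close> has a preimage inside the initial
      space.\<close>
    obtain m where m: "m \<in> initial_space V" "V (x - m) = 0"
      using initial_space_decomposition[OF partial_isometryD[OF D(3)]] by blast
    have "(m, y) \<in> A"
      using linear_operatorD(5)[OF S(1) x, of "x - m" 0] m(2) polar_modulus_kernel[OF pol] by simp
    then have "cinner u (V m - y) = 0" if "u \<in> initial_space V" for u
      using form[OF that m(1)] strictly_positiveD(6)[OF sp that m(1)] by (simp add: cinner_algebra)
    then have "V m - y \<in> orth (initial_space V)"
      by (rule orthI2)
    then show "\<exists>w\<in>initial_space V. V (V w - y) = 0"
      using m(1) orth_initial_space[OF partial_isometryD[OF D(3)]] by auto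
  qed
qed

text \<open>Take for \<open>P\<close> the projection onto the range of \<open>V\<close> and for
  \<open>Q\<close> the projection onto its initial space.\<close>

lemma strictly_positive_projection_product:
  fixes V :: "'a::complex_hilbert_space \<Rightarrow> 'a"
  assumes V: "strictly_positive V"
  obtains P Q A where "orthogonal_projection P" "orthogonal_projection Q"
    "polar_decomposition (op_graph (P \<circ> Q)) V A"
    "compression_onto V \<Longrightarrow> closed (range (P \<circ> Q))"
proof -
  note D = strictly_positiveD[OF V]
  note BV = bounded_operatorsD[OF D(2)]
  obtain P where P: "orthogonal_projection P" "\<And>x. P x \<in> range V" "\<And>x. x - P x \<in> orth (range V)"
    using ex_orthogonal_projection[OF csubspace_range[OF D(2)] closed_range_partial_isometry[OF D(1)]] by blast
  obtain Q where Q: "orthogonal_projection Q" "\<And>x. Q x \<in> initial_space V"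
      "\<And>x. x - Q x \<in> orth (initial_space V)"
    using ex_orthogonal_projection[OF csubspace_orth closed_orth] by blast
  note BP = bounded_operatorsD[OF orthogonal_projectionD(1)[OF P(1)]]
  note BQ = bounded_operatorsD[OF orthogonal_projectionD(1)[OF Q(1)]]
  \<comment> \<open>The graph of \<open>V^* P Q\<close>: as \<open>P\<close> maps into the range of
    \<open>V\<close>, the equation for \<open>w\<close> has exactly one solution in the initial
    space.\<close>
  define A where "A = {(x, w). w \<in> initial_space V \<and> V w = P (Q x)}"
  have A: "(x, w) \<in> A \<longleftrightarrow> w \<in> initial_space V \<and> V w = P (Q x)" for x w
    by (simp add: A_def)
  have lin: "linear_operator A"
    unfolding linear_operator_def single_valued_def A
    using csubspaceD[OF csubspace_orth[of "{x. V x = 0}"]] partial_isometry_inj[OF D(1)]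
    by (auto simp: BV BP BQ)
  have total: "\<exists>w. (x, w) \<in> A" for x
    using P(2)[of "Q x"] range_eq_image_initial_space[OF D(2)] unfolding A by (metis imageE)
  have VQ: "V (x - Q x) = 0" for x
    using Q(3)[of x] orth_initial_space[OF D(2)] by auto
  have form: "cinner w u = cinner (Q x) (V u)" if "(x, w) \<in> A" "u \<in> initial_space V" for x w u
  proof -
    have "cinner w u = cinner (V w) (V u)"
      using partial_isometry_cinner[OF D(1)] that A by metis
    also have "\<dots> = cinner (P (Q x)) (V u)"
      using that A by simp
    also have "\<dots> = cinner (Q x) (V u)"
      using orthD[OF P(3)[of "Q x"], of "V u"] by (simp add: cinner_diff_left)
    finally show ?thesis .
  qed
  \<comment> \<open>The form of \<open>A\<close> at \<open>x\<close> is that of \<open>V\<close> at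
    \<open>Q x\<close>, which transfers positivity to \<open>A\<close>.\<close>
  have diag: "cinner w x = cinner (V (Q x)) (Q x)" if w: "(x, w) \<in> A" for x w
  proof -
    have "cinner w x = cinner w (Q x)"
      using orthD[of w "{x. V x = 0}" "x - Q x"] w A VQ[of x] by (simp add: cinner_diff_right)
    also have "\<dots> = cinner (V (Q x)) (Q x)"
      using form[OF w Q(2)[of x]] D(6)[OF Q(2)[of x] Q(2)[of x]] by simp
    finally show ?thesis .
  qed
  have psa: "positive_selfadjoint A"
  proof (rule positive_selfadjoint_everywhere[OF lin])
    show "Domain A = UNIV"
      using total by blast
    show "cinner w x \<in> \<real> \<and> 0 \<le> Re (cinner w x)" if "(x, w) \<in> A" for x w
      using diag[OF that] D(3,4)[OF Q(2)[of x]] by simp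
  qed
  have graph: "op_graph (P \<circ> Q) = A O op_graph V"
    using total by (fastforce simp: op_graph_def A)
  have "P (Q x) = 0 \<longleftrightarrow> V x = 0" for x
  proof
    assume "P (Q x) = 0"
    then have "(x, 0) \<in> A"
      using csubspaceD(1)[OF csubspace_orth] by (simp add: A BV)
    then have "Q x = 0"
      using diag[of x 0] D(5)[OF Q(2)[of x]] by simp
    then show "V x = 0"
      using VQ[of x] by simp
  next
    assume "V x = 0"
    then have "V (Q x) = 0"
      using VQ[of x] by (simp add: BV)
    then have "Q x = 0"
      using orth_inter[of "Q x" "{x. V x = 0}"] Q(2) by blast
    then show "P (Q x) = 0"
      by (simp add: BP)
  qed
  then have "{x. V x = 0} = nullspace (A O op_graph V)"
    unfolding graph[symmetric] by (auto simp: nullspace_def op_graph_def)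
  then have pol: "polar_decomposition (op_graph (P \<circ> Q)) V A"
    unfolding graph using psa D(1) A by (intro polar_decompositionI) auto
  have "closed (range (P \<circ> Q))" if onto: "compression_onto V"
  proof -
    \<comment> \<open>A solution \<open>x\<close> of the compression equation for \<open>y\<close>
      is fixed by \<open>Q\<close> and sent to \<open>y\<close> by \<open>A\<close>, so the product
      sends \<open>x\<close> to \<open>V y\<close>. Its range is therefore all of
      \<open>range V\<close>.\<close>
    have "V y \<in> range (P \<circ> Q)" if y: "y \<in> initial_space V" for y
    proof -
      obtain x where x: "x \<in> initial_space V" "V (V x - y) = 0"
        using onto y unfolding compression_onto_def by blast
      obtain w where w: "(x, w) \<in> A"
        using total by blast
      have "Q x = x"
        using VQ[of x] x(1) Q(2)[of x] partial_isometry_inj[OF D(1)] by (metis BV(3) eq_iff_diff_eq_0)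
      have "w = y"
      proof (rule orth_cinner_eqI[OF csubspace_orth])
        fix u assume u: "u \<in> initial_space V"
        have "cinner w u = cinner (V x) u"
          using form[OF w u] D(6)[OF x(1) u] \<open>Q x = x\<close> by simp
        also have "\<dots> = cinner y u"
          using orthD2[OF u, of "V x - y"] x(2) by (simp add: cinner_diff_left)
        finally show "cinner w u = cinner y u" .
      qed (use w A y in auto)
      then show ?thesis
        using w A by (metis comp_apply rangeI)
    qed
    then have "V ` initial_space V \<subseteq> range (P \<circ> Q)"
      by blast
    moreover have "range (P \<circ> Q) \<subseteq> range V"
      using P(2) by auto
    ultimately have "range (P \<circ> Q) = range V"
      using range_eq_image_initial_space[OF D(2)] by auto
    then show ?thesis
      using closed_range_partial_isometry[OF D(1)] by simp
  qed
  with that P(1) Q(1) pol show ?thesis by blast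
qed

section \<open>Closed and bounded projections\<close>

text \<open>Closedness of \<open>Range E\<close> makes each \<open>w\<close> in the initial space a
  value of \<open>A\<close>, say at \<open>x\<close>. As \<open>x - V w\<close> lies in the kernel,
  the form of \<open>V\<close> at \<open>w\<close> is the conjugate of the form of \<open>A\<close>
  at \<open>x\<close>.\<close>

lemma closed_projection_strictly_positive:
  fixes V :: "'a::complex_hilbert_space \<Rightarrow> 'a"
  assumes E: "E \<in> closed_projections" and pol: "polar_decomposition E V A"
  shows "strictly_positive V" and "Domain E = UNIV \<Longrightarrow> compression_onto V"
proof -
  note D = polar_decompositionD[OF pol]
  note S = positive_selfadjointD[OF D(1)]
  note BV = bounded_operatorsD[OF partial_isometryD[OF D(3)]]
  have linE: "linear_operator E" and cl: "closed (Range E)" and idem: "\<And>x y. (x, y) \<in> E \<Longrightarrow> (y, y) \<in> E"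
    using E by (auto simp: closed_projections_def)
  have R: "Range A = initial_space V"
    by (rule polar_modulus_Range_eq[OF pol cl])
  \<comment> \<open>Idempotence: \<open>E\<close> fixes its value \<open>V w\<close> at
    \<open>x\<close>, so \<open>x - V w\<close> is in the nullspace of \<open>E\<close>.\<close>
  have ker: "V (x - V w) = 0" if "(x, w) \<in> A" for x w
  proof -
    have "(x, V w) \<in> E"
      using D(6) that by blast
    then have "(x - V w, V w - V w) \<in> E"
      by (intro linear_operatorD(5)[OF linE]) (auto intro: idem)
    then show ?thesis
      using D(4) by (auto simp: nullspace_def)
  qed
  have form: "cinner (V w) w = cinner x w" if "(x, w) \<in> A" for x w
  proof -
    have "w \<in> initial_space V"
      using R that by blast
    then show ?thesis
      using orthD2[of w "{x. V x = 0}" "x - V w"] ker[OF that] by (simp add: cinner_diff_left)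
  qed
  have "cinner (V w) w \<in> \<real> \<and> 0 < Re (cinner (V w) w)" if w: "w \<in> initial_space V" "w \<noteq> 0" for w
  proof -
    obtain x where x: "(x, w) \<in> A"
      using R w by blast
    have eq: "cinner (V w) w = cnj (cinner w x)"
      using form[OF x] by (metis cinner_commute)
    have "Re (cinner w x) \<noteq> 0"
      using S(7)[OF x] w(2) by blast
    then show ?thesis
      using S(4,5)[OF x] by (simp add: eq Reals_cnj_iff)
  qed
  then show "strictly_positive V"
    using D(3) by (simp add: strictly_positive_def)
  show "compression_onto V" if dom: "Domain E = UNIV"
    unfolding compression_onto_def
  proof
    fix y assume "y \<in> initial_space V"
    obtain w where w: "(y, w) \<in> A"
      using dom D(6) by blast
    then have "V (V w - y) = 0"
      using ker by (simp add: BV)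
    then show "\<exists>w\<in>initial_space V. V (V w - y) = 0"
      using w R by blast
  qed
qed

text \<open>Idempotence turns the range into the set of fixed points, which is closed by
  continuity.\<close>

lemma bounded_projection_closed:
  assumes e: "e \<in> bounded_projections"
  shows "op_graph e \<in> closed_projections" "Domain (op_graph e) = UNIV"
proof -
  have eb: "e \<in> bounded_operators" and idem: "e (e x) = e x" for x
    using e by (auto simp: bounded_projections_def fun_eq_iff)
  note B = bounded_operatorsD[OF eb]
  have G: "(x, y) \<in> op_graph e \<longleftrightarrow> y = e x" for x y
    by (auto simp: op_graph_def)
  show dom: "Domain (op_graph e) = UNIV"
    by (auto simp: G Domain_iff)
  have null: "nullspace (op_graph e) = {x. e x = 0}"
    by (auto simp: nullspace_def G)
  have ran: "Range (op_graph e) = {x. e x = x}"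
    using idem by (auto simp: Range_iff G) metis
  have "linear_operator (op_graph e)"
    by (auto simp: linear_operator_def single_valued_def G B)
  moreover have "\<exists>n r. x = n + r \<and> e n = 0 \<and> e r = r" for x
    by (rule exI[of _ "x - e x"], rule exI[of _ "e x"]) (simp add: B idem)
  then have "Domain (op_graph e) = {n + r | n r. n \<in> nullspace (op_graph e) \<and> r \<in> Range (op_graph e)}"
    unfolding dom null ran by auto
  moreover have "nullspace (op_graph e) \<inter> Range (op_graph e) = {0}"
    unfolding null ran by (auto simp: B)
  moreover have "closed (Range (op_graph e))"
    unfolding ran by (intro closed_Collect_eq continuous_intros linear_continuous_on B)
  ultimately show "op_graph e \<in> closed_projections"
    unfolding closed_projections_def densely_defined_def
    using closed_kernel[OF eb] null idem by (auto simp: dom G)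
qed

text \<open>The inverse of the compression, extended by zero on the kernel of \<open>V\<close>,
  serves as modulus; followed by \<open>V\<close> it is the projection onto \<open>range V\<close>
  along that kernel.\<close>

lemma strictly_positive_closed_projection:
  fixes V :: "'a::complex_hilbert_space \<Rightarrow> 'a"
  assumes V: "strictly_positive V"
  obtains E A where "E \<in> closed_projections" "polar_decomposition E V A"
    "compression_onto V \<Longrightarrow> E \<in> op_graph ` bounded_projections"
proof -
  note D = strictly_positiveD[OF V]
  note BV = bounded_operatorsD[OF D(2)]
  note sub = csubspaceD[OF csubspace_orth[of "{x. V x = 0}"]]
  \<comment> \<open>The condition says that \<open>x\<close> and \<open>V w\<close> have the same
    component in the initial space; the inverse of the compression sends this component to
    \<open>w\<close>.\<close>
  define A where "A = {(x, w). w \<in> initial_space V \<and> V (x - V w) = 0}"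
  have A: "(x, w) \<in> A \<longleftrightarrow> w \<in> initial_space V \<and> V (x - V w) = 0" for x w
    by (simp add: A_def)
  \<comment> \<open>Injectivity of the compression: \<open>V w\<close> in the kernel is orthogonal
    to \<open>w\<close>, and strict positivity then gives \<open>w = 0\<close>.\<close>
  have null: "w = 0" if "w \<in> initial_space V" "V (V w) = 0" for w
    using orthD2[OF that(1), of "V w"] that D(5) by simp
  have sv: "w = w'" if "(x, w) \<in> A" "(x, w') \<in> A" for x w w'
    using null[of "w - w'"] that sub(3)[of w w'] by (simp add: A BV)
  have lin: "linear_operator A"
    unfolding linear_operator_def single_valued_def
  proof (intro conjI allI impI)
    show "w = w'" if "(x, w) \<in> A" "(x, w') \<in> A" for x w w'
      using sv that .
  qed (use sub in \<open>auto simp: A BV\<close>)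
  have form: "cinner x u = cinner (V w) u" if "(x, w) \<in> A" "u \<in> initial_space V" for x w u
    using orthD2[OF that(2), of "x - V w"] that(1) by (simp add: A cinner_diff_left)
  have dd: "densely_defined A"
    unfolding densely_defined_def
  proof (intro dense_if_orth_trivial csubspace_Domain lin subsetI)
    fix y assume y: "y \<in> orth (Domain A)"
    \<comment> \<open>Kernel vectors belong to the domain, which puts \<open>y\<close> in the
      initial space. Then \<open>V y\<close> is in the domain too, and its orthogonality to
      \<open>y\<close> forces \<open>y = 0\<close>.\<close>
    have "n \<in> Domain A" if "V n = 0" for n
      using that sub(1) by (auto simp: Domain_iff A BV intro!: exI[of _ 0])
    then have yM: "y \<in> initial_space V"
      using orthD[OF y] by (simp add: orth_def)
    then have "(V y, y) \<in> A"
      by (simp add: A BV)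
    then have "cinner (V y) y = 0"
      using orthD2[OF y] by blast
    then show "y \<in> {0}"
      using D(5)[OF yM] by simp
  qed
  have sym: "cinner w y = cinner x z" if "(x, w) \<in> A" "(y, z) \<in> A" for x w y z
  proof -
    have wz: "w \<in> initial_space V" "z \<in> initial_space V"
      using that by (auto simp: A)
    have "cinner w y = cinner w (V z)"
      using form[OF that(2) wz(1)] by (metis cinner_commute)
    also have "\<dots> = cinner x z"
      using form[OF that(1) wz(2)] D(6)[OF wz] by simp
    finally show ?thesis .
  qed
  \<comment> \<open>Testing with kernel vectors, whose image is 0, puts \<open>z\<close> in the
    initial space; testing with \<open>V w\<close>, whose image is \<open>w\<close>, makes
    \<open>y - V z\<close> orthogonal to that space.\<close>
  have adj: "(y, z) \<in> A" if *: "\<And>x w. (x, w) \<in> A \<Longrightarrow> cinner w y = cinner x z" for y z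
  proof -
    have "cinner n z = 0" if "V n = 0" for n
      using *[of n 0] that sub(1) by (simp add: A BV)
    then have zM: "z \<in> initial_space V"
      by (intro orthI2) simp
    have "cinner w (y - V z) = 0" if w: "w \<in> initial_space V" for w
      using *[of "V w" w] w D(6)[OF w zM] by (simp add: A BV cinner_diff_right)
    then have "y - V z \<in> orth (initial_space V)"
      by (rule orthI2)
    then show ?thesis
      using zM orth_initial_space[OF D(2)] by (auto simp: A)
  qed
  have pos: "cinner w x \<in> \<real> \<and> 0 \<le> Re (cinner w x)" if "(x, w) \<in> A" for x w
  proof -
    have w: "w \<in> initial_space V"
      using that by (simp add: A)
    have "cinner w x = cnj (cinner (V w) w)"
      using form[OF that w] by (metis cinner_commute)
    then show ?thesis
      using D(3,4)[OF w] by (simp add: Reals_cnj_iff)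
  qed
  have psa: "positive_selfadjoint A"
    unfolding positive_selfadjoint_def
  proof (intro conjI equalityI subrelI lin dd)
    show "(y, z) \<in> A" if "(y, z) \<in> op_adjoint A" for y z
      using that by (intro adj) (auto simp: op_adjoint_def)
    show "(y, z) \<in> op_adjoint A" if "(y, z) \<in> A" for y z
      using sym that by (auto simp: op_adjoint_def)
    show "\<forall>(x, w)\<in>A. cinner w x \<in> \<real> \<and> 0 \<le> Re (cinner w x)"
      using pos by blast
  qed
  define E where "E = A O op_graph V"
  have E: "(x, y) \<in> E \<longleftrightarrow> (\<exists>w. (x, w) \<in> A \<and> y = V w)" for x y
    by (auto simp: E_def op_graph_def)
  have nullE: "nullspace E = {x. V x = 0}"
  proof (intro equalityI subsetI)
    fix x assume "x \<in> nullspace E"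
    then obtain w where "(x, w) \<in> A" "V w = 0"
      by (auto simp: nullspace_def E)
    then show "x \<in> {x. V x = 0}"
      by (simp add: A BV)
  next
    fix x assume "x \<in> {x. V x = 0}"
    then have "(x, 0) \<in> A"
      using sub(1) by (simp add: A BV)
    then show "x \<in> nullspace E"
      using BV(5) by (auto simp: nullspace_def E)
  qed
  have pol: "polar_decomposition E V A"
    unfolding E_def using psa D(1) nullE
    by (intro polar_decompositionI) (auto simp: A E_def)
  have diagA: "(V w, w) \<in> A" if "w \<in> initial_space V" for w
    using that by (simp add: A BV)
  have ranE: "Range E = V ` initial_space V"
  proof (intro equalityI subsetI)
    show "y \<in> V ` initial_space V" if "y \<in> Range E" for y
      using that unfolding Range_iff E A by blast
    show "y \<in> Range E" if "y \<in> V ` initial_space V" for y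
      using that diagA unfolding Range_iff E by blast
  qed
  have domE: "Domain E = Domain A"
    using E by blast
  have idem: "(y, y) \<in> E" if "(x, y) \<in> E" for x y
  proof -
    have "\<exists>w. (x, w) \<in> A \<and> y = V w"
      using that by (simp only: E)
    then obtain w where w: "(x, w) \<in> A" "y = V w"
      by blast
    then have "(y, w) \<in> A"
      by (simp add: A BV)
    then show ?thesis
      using w(2) E[of y y] by blast
  qed
  have linE: "linear_operator E"
    unfolding linear_operator_def single_valued_def
  proof (intro conjI allI impI)
    show "(0, 0) \<in> E"
      using linear_operatorD(2)[OF lin] BV(5) by (auto simp: E)
    show "y = y'" if "(x, y) \<in> E" "(x, y') \<in> E" for x y y'
      using that sv unfolding E by blast
    show "(x + x', y + y') \<in> E" if "(x, y) \<in> E" "(x', y') \<in> E" for x y x' y'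
      using that linear_operatorD(3)[OF lin] BV(2) unfolding E by metis
    show "(c *\<^sub>C x, c *\<^sub>C y) \<in> E" if "(x, y) \<in> E" for c x y
      using that linear_operatorD(4)[OF lin] BV(4) unfolding E by metis
  qed
  have sum: "Domain E = {n + r | n r. n \<in> nullspace E \<and> r \<in> Range E}"
  proof (intro equalityI subsetI)
    fix x assume "x \<in> Domain E"
    then obtain w where "w \<in> initial_space V" "V (x - V w) = 0"
      unfolding domE by (auto simp: A)
    then have "x = (x - V w) + V w \<and> x - V w \<in> nullspace E \<and> V w \<in> Range E"
      unfolding nullE ranE by simp
    then show "x \<in> {n + r | n r. n \<in> nullspace E \<and> r \<in> Range E}"
      by blast
  next
    fix x assume "x \<in> {n + r | n r. n \<in> nullspace E \<and> r \<in> Range E}"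
    then obtain n w where "x = n + V w" "V n = 0" "w \<in> initial_space V"
      unfolding nullE ranE by auto
    then have "(x, w) \<in> A"
      by (simp add: A)
    then show "x \<in> Domain E"
      unfolding domE by blast
  qed
  have "nullspace E \<inter> Range E = {0}"
    unfolding nullE ranE using null sub(1) BV(5) by (auto simp: image_iff)
  moreover have "closed (Range E)"
    unfolding ranE using closed_range_partial_isometry[OF D(1)] range_eq_image_initial_space[OF D(2)] by simp
  ultimately have cp: "E \<in> closed_projections"
    unfolding closed_projections_def mem_Collect_eq
  proof (intro conjI linE sum)
    show "densely_defined E"
      using dd by (simp add: densely_defined_def domE)
    show "closed (nullspace E)"
      unfolding nullE by (rule closed_kernel[OF D(2)])
    show "\<forall>(x, y)\<in>E. (y, y) \<in> E"
      using idem by blast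
  qed
  have "E \<in> op_graph ` bounded_projections" if onto: "compression_onto V"
  proof -
    \<comment> \<open>Only the component \<open>m\<close> of \<open>x\<close> in the initial space
      matters, and surjectivity of the compression supplies \<open>w\<close> for it.\<close>
    have "\<exists>w. (x, w) \<in> A" for x
    proof -
      obtain m where m: "m \<in> initial_space V" "V (x - m) = 0"
        using initial_space_decomposition[OF D(2)] by blast
      then obtain w where "w \<in> initial_space V" "V (V w - m) = 0"
        using onto unfolding compression_onto_def by blast
      then have "(x, w) \<in> A"
        using m(2) by (simp add: A BV)
      then show ?thesis ..
    qed
    then obtain a where a: "\<And>x. (x, a x) \<in> A"
      by metis
    have aI: "a x = w" if "(x, w) \<in> A" for x w
      using sv a that by blast
    have a_add: "a (x + y) = a x + a y" for x y
      by (intro aI linear_operatorD(3)[OF lin] a)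
    have a_scale: "a (c *\<^sub>C x) = c *\<^sub>C a x" for c x
      by (intro aI linear_operatorD(4)[OF lin] a)
    \<comment> \<open>An everywhere defined symmetric map is automatically bounded; no explicit
      bound for the inverse of the compression is computed.\<close>
    have "bounded_linear a"
    proof (rule Hellinger_Toeplitz)
      show "linear a"
        by (intro linearI) (simp_all add: a_add a_scale scaleR_scaleC)
      show "inner (a x) y = inner x (a y)" for x y
        using sym[OF a[of x] a[of y]] by (simp add: inner_eq_Re_cinner)
    qed
    then have "V \<circ> a \<in> bounded_operators"
      using bounded_linear_compose[OF BV(1)] by (simp add: bounded_operators_def o_def a_scale BV(4))
    moreover have G: "E = op_graph (V \<circ> a)"
    proof (intro equalityI subrelI)
      show "(x, y) \<in> op_graph (V \<circ> a)" if "(x, y) \<in> E" for x y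
        using that aI by (auto simp: E op_graph_def)
      show "(x, y) \<in> E" if "(x, y) \<in> op_graph (V \<circ> a)" for x y
        using that a by (auto simp: E op_graph_def)
    qed
    \<comment> \<open>On the initial space \<open>a\<close> inverts \<open>V\<close>, so
      \<open>a (V (a x)) = a x\<close>.\<close>
    moreover have "(V \<circ> a) \<circ> (V \<circ> a) = V \<circ> a"
    proof
      fix x
      have "a x \<in> initial_space V"
        using a[of x] by (simp add: A)
      then show "((V \<circ> a) \<circ> (V \<circ> a)) x = (V \<circ> a) x"
        using aI[OF diagA] by simp
    qed
    ultimately show ?thesis
      by (auto simp: bounded_projections_def)
  qed
  with that cp pol show ?thesis by blast
qed

section \<open>Characterizations of the four sets of isometric parts\<close>

lemma isometric_partsI: "C \<in> \<A> \<Longrightarrow> polar_decomposition C V A \<Longrightarrow> V \<in> isometric_parts \<A>"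
  unfolding isometric_parts_def by blast

lemma isometric_partsE:
  assumes "V \<in> isometric_parts \<A>"
  obtains C A where "C \<in> \<A>" "polar_decomposition C V A"
  using assms unfolding isometric_parts_def by blast

lemma isometric_parts_projection_products:
  "isometric_parts (op_graph ` projection_products) = {V. strictly_positive V}"
proof (intro equalityI subsetI)
  fix V :: "'a \<Rightarrow> 'a"
  assume "V \<in> isometric_parts (op_graph ` projection_products)"
  then obtain P Q A where "orthogonal_projection P" "orthogonal_projection Q"
    "polar_decomposition (op_graph (P \<circ> Q)) V A"
    by (auto elim!: isometric_partsE simp: projection_products_def)
  then show "V \<in> {V. strictly_positive V}"
    using projection_product_strictly_positive(1) by blast
next
  fix V :: "'a \<Rightarrow> 'a"
  assume "V \<in> {V. strictly_positive V}"
  then obtain P Q A where "orthogonal_projection P" "orthogonal_projection Q"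
    "polar_decomposition (op_graph (P \<circ> Q)) V A"
    using strictly_positive_projection_product by blast
  then show "V \<in> isometric_parts (op_graph ` projection_products)"
    by (intro isometric_partsI[of "op_graph (P \<circ> Q)"]) (auto simp: projection_products_def)
qed

lemma isometric_parts_projection_products_cr:
  "isometric_parts (op_graph ` projection_products_cr) = {V. strictly_positive V \<and> compression_onto V}"
proof (intro equalityI subsetI)
  fix V :: "'a \<Rightarrow> 'a"
  assume "V \<in> isometric_parts (op_graph ` projection_products_cr)"
  then obtain P Q A where "orthogonal_projection P" "orthogonal_projection Q"
    "polar_decomposition (op_graph (P \<circ> Q)) V A" "closed (range (P \<circ> Q))"
    by (auto elim!: isometric_partsE simp: projection_products_cr_def projection_products_def)
  then show "V \<in> {V. strictly_positive V \<and> compression_onto V}"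
    using projection_product_strictly_positive by blast
next
  fix V :: "'a \<Rightarrow> 'a"
  assume V: "V \<in> {V. strictly_positive V \<and> compression_onto V}"
  then obtain P Q A where "orthogonal_projection P" "orthogonal_projection Q"
    "polar_decomposition (op_graph (P \<circ> Q)) V A" "closed (range (P \<circ> Q))"
    using strictly_positive_projection_product[of V] by blast
  then show "V \<in> isometric_parts (op_graph ` projection_products_cr)"
    unfolding projection_products_cr_def projection_products_def
    by (intro isometric_partsI[of "op_graph (P \<circ> Q)"] imageI) blast+
qed

lemma isometric_parts_closed_projections:
  "isometric_parts closed_projections = {V. strictly_positive V}"
proof (intro equalityI subsetI)
  fix V :: "'a \<Rightarrow> 'a"
  assume "V \<in> isometric_parts closed_projections"
  then show "V \<in> {V. strictly_positive V}"
    using closed_projection_strictly_positive(1) by (blast elim: isometric_partsE)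
next
  fix V :: "'a \<Rightarrow> 'a"
  assume "V \<in> {V. strictly_positive V}"
  then show "V \<in> isometric_parts closed_projections"
    using strictly_positive_closed_projection isometric_partsI by (metis mem_Collect_eq)
qed

text \<open>Bounded projections are treated as closed projections with full domain; conversely, the
  closed projection built from \<open>V\<close> is bounded once the compression is onto.\<close>

lemma isometric_parts_bounded_projections:
  "isometric_parts (op_graph ` bounded_projections) = {V. strictly_positive V \<and> compression_onto V}"
proof (intro equalityI subsetI)
  fix V :: "'a \<Rightarrow> 'a"
  assume "V \<in> isometric_parts (op_graph ` bounded_projections)"
  then obtain e A where "e \<in> bounded_projections" "polar_decomposition (op_graph e) V A"
    by (blast elim: isometric_partsE)
  then show "V \<in> {V. strictly_positive V \<and> compression_onto V}"
    using closed_projection_strictly_positive bounded_projection_closed by blast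
next
  fix V :: "'a \<Rightarrow> 'a"
  assume "V \<in> {V. strictly_positive V \<and> compression_onto V}"
  then show "V \<in> isometric_parts (op_graph ` bounded_projections)"
    using strictly_positive_closed_projection[of V] isometric_partsI by (metis mem_Collect_eq)
qed

theorem corollary6p4:
  shows "isometric_parts (op_graph ` (projection_products :: ('a::complex_hilbert_space \<Rightarrow> 'a) set))
           = isometric_parts closed_projections \<and>
         isometric_parts (op_graph ` (projection_products_cr :: ('a \<Rightarrow> 'a) set))
           = isometric_parts (op_graph ` bounded_projections)"
  by (simp add: isometric_parts_projection_products isometric_parts_projection_products_cr
      isometric_parts_closed_projections isometric_parts_bounded_projections)

end
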